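(* Let $\mathbb{F}$ be a field and let $f\in\mathbb{F}[x_1,\ldots,x_n]$ be defined by $f(\overline{x})=\prod_{1\le i<j\le n}(x_i+x_j+\alpha_{i,j})$ for $\alpha_{i,j}\in\mathbb{F}$. Then for any $0\ne g\in\mathbb{F}[\overline{x}]$, $g\cdot f$ requires width $2^{\Omega(n)}$ as a read-twice oblivious algebraic branching program.
   Context: A width-$r$ read-twice oblivious algebraic branching program on $x_1,\ldots,x_n$ is a directed acyclic graph with $2n+1$ vertex layers $V_0=\{s\},V_1,\ldots,V_{2n}=\{t\}$, $|V_i|\le r$, edges only from $V_{i-1}$ to $V_i$, where for each $1\le\ell\le2n$ all edges from $V_{\ell-1}$ to $V_\ell$ are labelled by univariate polynomials in a single variable $x_{i_\ell}$, and each variable $x_i$ is the variable of exactly two of the $2n$ edge layers (in arbitrary order). It computes the sum over all $s$–$t$ paths of the product of the edge labels. The constant in $\Omega$ is absolute and positive. *)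

theory Defs
  imports Complex_Main "HOL-Library.Disjoint_Sets" "HOL-Library.Poly_Mapping"
begin

(* A monomial is its finitely supported exponent vector; a polynomial is the finitely
   supported map from monomials to coefficients, multiplied by convolution. *)
type_synonym 'a mpoly = "(nat \<Rightarrow>\<^sub>0 nat) \<Rightarrow>\<^sub>0 'a"

definition mconst :: "'a::zero \<Rightarrow> 'a mpoly" where
  "mconst c = Poly_Mapping.single 0 c"

definition mvar :: "nat \<Rightarrow> 'a::zero_neq_one mpoly" where
  "mvar i = Poly_Mapping.single (Poly_Mapping.single i 1) 1"

(* The subring F[x_i : i in S]. *)

definition mpolys_in :: "nat set \<Rightarrow> 'a::zero mpoly set" where
  "mpolys_in S = {p. \<forall>m \<in> Poly_Mapping.keys p. Poly_Mapping.keys m \<subseteq> S}"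

record (overloaded) ('v, 'a) abp =
  layer :: "nat \<Rightarrow> 'v set"
  edges :: "('v \<times> 'v) set"
  label :: "'v \<times> 'v \<Rightarrow> 'a mpoly"
  source :: 'v
  sink :: 'v
  read_var :: "nat \<Rightarrow> nat"  (* index of the variable read by the edges entering layer l *)

(* The vertices are those in layers 0..2n; the values of layer and read_var at other
   indices, and of label at non-edges, play no role. Finiteness of the layers is explicit
   because card is 0 on infinite sets. *)
definition read_twice_oblivious_abp ::
    "nat \<Rightarrow> nat \<Rightarrow> ('v, 'a::zero) abp \<Rightarrow> bool" where
  "read_twice_oblivious_abp n r B \<longleftrightarrow>
     layer B 0 = {source B} \<and> layer B (2 * n) = {sink B} \<and>
     disjoint_family_on (layer B) {0..2 * n} \<and>
     (\<forall>l \<in> {0..2 * n}. finite (layer B l) \<and> card (layer B l) \<le> r) \<and>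
     edges B \<subseteq> (\<Union>l \<in> {1..2 * n}. layer B (l - 1) \<times> layer B l) \<and>
     (\<forall>l \<in> {1..2 * n}. \<forall>e \<in> edges B \<inter> layer B (l - 1) \<times> layer B l.
        label B e \<in> mpolys_in {read_var B l}) \<and>
     (\<forall>l \<in> {1..2 * n}. read_var B l \<in> {1..n}) \<and>
     (\<forall>i \<in> {1..n}. card {l \<in> {1..2 * n}. read_var B l = i} = 2)"

definition paths :: "('v \<times> 'v) set \<Rightarrow> 'v \<Rightarrow> 'v \<Rightarrow> 'v list set" where
  "paths E s t = {vs. vs \<noteq> [] \<and> hd vs = s \<and> last vs = t \<and>
                      successively (\<lambda>u v. (u, v) \<in> E) vs}"

definition abp_poly :: "('v, 'a::comm_ring_1) abp \<Rightarrow> 'a mpoly" where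
  "abp_poly B = (\<Sum>vs \<in> paths (edges B) (source B) (sink B).
                   prod_list (map (label B) (zip vs (tl vs))))"

definition pair_product :: "nat \<Rightarrow> (nat \<Rightarrow> nat \<Rightarrow> 'a::comm_ring_1) \<Rightarrow> 'a mpoly" where
  "pair_product n \<alpha> =
     (\<Prod>(i, j) \<in> {(i, j). 1 \<le> i \<and> i < j \<and> j \<le> n}. mvar i + mvar j + mconst (\<alpha> i j))"

end

theory Submission
  imports Defs
begin

text \<open>
  Since every variable is read only twice, there are disjoint sets \<open>X\<close>, \<open>Y\<close> of \<open>m\<close> variables each,
  with \<open>m\<close> proportional to \<open>n\<close>, and three cuts of the reading sequence such that no segment between
  cuts reads from both \<open>X\<close> and \<open>Y\<close>. Summing over the vertices at the cuts writes \<open>g f\<close> as a sum of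
  \<open>r\<^sup>3\<close> products of a \<open>Y\<close>-free and an \<open>X\<close>-free polynomial. On the other hand \<open>g f\<close> is a nonzero
  multiple of the product of \<open>x + \<pi> x + \<beta>\<close> over a matching \<open>\<pi>\<close> from \<open>X\<close> to \<open>Y\<close>. The matrix of its
  coefficients, rows indexed by monomials in \<open>X\<close>, columns by monomials in \<open>Y\<close> and entries being
  polynomials in the remaining variables, contains a triangular submatrix of size \<open>2\<^sup>m\<close> with nonzero
  diagonal, so \<open>2\<^sup>m \<le> r\<^sup>3\<close>. The submatrix doubles with each matched pair, because multiplication by
  \<open>x + y + \<beta>\<close> produces two distinct extreme monomials in the top-degree part.
\<close>

section \<open>Coefficient extraction\<close>

text \<open>The coefficient of the \<open>k\<close>-th power of variable \<open>v\<close>, as a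
  polynomial in the other variables: the test on \<open>m\<close> keeps \<open>v\<close> out of the
  result. Staying in one type lets extractions be composed.\<close>

lift_definition mcoeff :: "nat \<Rightarrow> nat \<Rightarrow> 'a::zero mpoly \<Rightarrow> 'a mpoly" is
  "\<lambda>v k p m. if Poly_Mapping.lookup m v = 0 then p (m + Poly_Mapping.single v k) else 0"
proof -
  fix v k :: nat and p :: "(nat \<Rightarrow>\<^sub>0 nat) \<Rightarrow> 'a"
  assume "finite {m. p m \<noteq> 0}"
  then have "finite ((\<lambda>m. m + Poly_Mapping.single v k) -` {m. p m \<noteq> 0})"
    by (rule finite_vimageI) (simp add: inj_on_def)
  then show "finite {m. (if Poly_Mapping.lookup m v = 0 then p (m + Poly_Mapping.single v k) else 0) \<noteq> 0}"
    by (rule rev_finite_subset) (auto split: if_splits)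
qed

lemma lookup_mcoeff:
  "Poly_Mapping.lookup (mcoeff v k p) m =
     (if Poly_Mapping.lookup m v = 0 then Poly_Mapping.lookup p (m + Poly_Mapping.single v k) else 0)"
  by transfer simp

lemma mcoeff_0 [simp]: "mcoeff v k 0 = 0"
  by (rule poly_mapping_eqI) (simp add: lookup_mcoeff)

lemma mcoeff_add: "mcoeff v k (p + q) = mcoeff v k p + mcoeff v k q"
  by (rule poly_mapping_eqI) (simp add: lookup_mcoeff lookup_add)

lemma mcoeff_single:
  "mcoeff v k (Poly_Mapping.single m c) =
     (if Poly_Mapping.lookup m v = k then Poly_Mapping.single (m - Poly_Mapping.single v k) c else 0)"
proof (rule poly_mapping_eqI)
  fix m'
  have "m' + Poly_Mapping.single v k = m \<and> Poly_Mapping.lookup m' v = 0 \<longleftrightarrow>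
        Poly_Mapping.lookup m v = k \<and> m' = m - Poly_Mapping.single v k"
    by (auto simp: poly_mapping_eq_iff fun_eq_iff lookup_add lookup_minus lookup_single when_def)
  then show "Poly_Mapping.lookup (mcoeff v k (Poly_Mapping.single m c)) m' =
    Poly_Mapping.lookup (if Poly_Mapping.lookup m v = k
      then Poly_Mapping.single (m - Poly_Mapping.single v k) c else 0) m'"
    by (auto simp: lookup_mcoeff lookup_single when_def)
qed

lemma mcoeff_commute:
  assumes "v \<noteq> w"
  shows "mcoeff v k (mcoeff w l p) = mcoeff w l (mcoeff v k p)"
  using assms by (intro poly_mapping_eqI) (simp add: lookup_mcoeff lookup_add lookup_single ac_simps)

section \<open>Polynomials in a given set of variables\<close>

lemma mpolys_inI:
  "(\<And>m i. Poly_Mapping.lookup p m \<noteq> 0 \<Longrightarrow> Poly_Mapping.lookup m i \<noteq> 0 \<Longrightarrow> i \<in> S) \<Longrightarrow> p \<in> mpolys_in S"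
  by (auto simp: mpolys_in_def in_keys_iff)

lemma mpolys_inD:
  "p \<in> mpolys_in S \<Longrightarrow> Poly_Mapping.lookup p m \<noteq> 0 \<Longrightarrow> i \<notin> S \<Longrightarrow> Poly_Mapping.lookup m i = 0"
  by (force simp: mpolys_in_def in_keys_iff)

lemma mpolys_in_mono: "p \<in> mpolys_in S \<Longrightarrow> S \<subseteq> T \<Longrightarrow> p \<in> mpolys_in T"
  by (force simp: mpolys_in_def)

lemma mpolys_in_0 [simp]: "0 \<in> mpolys_in S"
  by (simp add: mpolys_in_def)

lemma mpolys_in_1 [simp]: "(1::'a::zero_neq_one mpoly) \<in> mpolys_in S"
  by (simp add: mpolys_in_def)

lemma mconst_in_mpolys_in [simp]: "mconst c \<in> mpolys_in S"
  by (simp add: mpolys_in_def mconst_def)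

lemma mvar_in_mpolys_in: "v \<in> S \<Longrightarrow> (mvar v :: 'a::zero_neq_one mpoly) \<in> mpolys_in S"
  by (simp add: mpolys_in_def mvar_def)

lemma mpolys_in_add: "p \<in> mpolys_in S \<Longrightarrow> q \<in> mpolys_in S \<Longrightarrow> p + q \<in> mpolys_in S"
  using keys_add[of p q] by (auto simp: mpolys_in_def)

lemma mpolys_in_mult:
  fixes p q :: "'a::semiring_0 mpoly"
  assumes "p \<in> mpolys_in S" "q \<in> mpolys_in S"
  shows "p * q \<in> mpolys_in S"
  unfolding mpolys_in_def
proof safe
  fix m i assume m: "m \<in> Poly_Mapping.keys (p * q)" and i: "i \<in> Poly_Mapping.keys m"
  from m obtain a b where "m = a + b" "a \<in> Poly_Mapping.keys p" "b \<in> Poly_Mapping.keys q"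
    using keys_mult[of p q] by blast
  with i assms keys_add[of a b] show "i \<in> S"
    unfolding mpolys_in_def by blast
qed

lemma mpolys_in_sum: "(\<And>k. k \<in> K \<Longrightarrow> p k \<in> mpolys_in S) \<Longrightarrow> sum p K \<in> mpolys_in S"
  by (induction K rule: infinite_finite_induct) (auto intro: mpolys_in_add)

lemma mpolys_in_prod:
  fixes p :: "'k \<Rightarrow> 'a::comm_semiring_1 mpoly"
  shows "(\<And>k. k \<in> K \<Longrightarrow> p k \<in> mpolys_in S) \<Longrightarrow> prod p K \<in> mpolys_in S"
  by (induction K rule: infinite_finite_induct) (auto intro: mpolys_in_mult)

lemma mcoeff_in_mpolys_in: "p \<in> mpolys_in S \<Longrightarrow> mcoeff v k p \<in> mpolys_in (S - {v})"
  by (rule mpolys_inI)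
     (auto simp: lookup_mcoeff lookup_add split: if_splits dest!: mpolys_inD)

lemma mpoly_sum_single:
  fixes p :: "'a::comm_monoid_add mpoly"
  shows "p = (\<Sum>m\<in>Poly_Mapping.keys p. Poly_Mapping.single m (Poly_Mapping.lookup p m))"
  by (rule poly_mapping_eqI) (auto simp: lookup_sum lookup_single when_def sum.delta in_keys_iff)

lemma mcoeff_sum: "mcoeff v k (sum p K) = (\<Sum>i\<in>K. mcoeff v k (p i))"
  by (induction K rule: infinite_finite_induct) (auto simp: mcoeff_add)

text \<open>Extraction at \<open>v\<close> treats polynomials free of \<open>v\<close> as scalars;
  by additivity single terms suffice.\<close>

lemma mcoeff_mult_left:
  fixes p q :: "'a::comm_semiring_1 mpoly"
  assumes p: "p \<in> mpolys_in (- {v})"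
  shows "mcoeff v k (p * q) = p * mcoeff v k q"
proof -
  have single: "mcoeff v k (Poly_Mapping.single a c * Poly_Mapping.single b d) =
      Poly_Mapping.single a c * mcoeff v k (Poly_Mapping.single b d)"
    if a: "Poly_Mapping.lookup a v = 0" for a b :: "nat \<Rightarrow>\<^sub>0 nat" and c d :: 'a
  proof -
    \<comment> \<open>Exponent subtraction truncates; since \<open>a\<close> has exponent 0 at
      \<open>v\<close>, all of it acts on \<open>b\<close>.\<close>
    have "a + b - Poly_Mapping.single v k = a + (b - Poly_Mapping.single v k)"
      using a by (auto simp: poly_mapping_eq_iff fun_eq_iff lookup_add lookup_minus lookup_single when_def)
    with a show ?thesis
      by (simp add: mult_single mcoeff_single lookup_add)
  qed
  let ?s = "\<lambda>r m. Poly_Mapping.single m (Poly_Mapping.lookup r m)"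
  have "mcoeff v k (p * q) =
      mcoeff v k ((\<Sum>a\<in>Poly_Mapping.keys p. ?s p a) * (\<Sum>b\<in>Poly_Mapping.keys q. ?s q b))"
    using mpoly_sum_single[of p] mpoly_sum_single[of q] by simp
  also have "\<dots> = (\<Sum>a\<in>Poly_Mapping.keys p. \<Sum>b\<in>Poly_Mapping.keys q. ?s p a * mcoeff v k (?s q b))"
    unfolding sum_product mcoeff_sum
    by (intro sum.cong refl single) (use p in \<open>auto simp: mpolys_in_def in_keys_iff\<close>)
  also have "\<dots> = (\<Sum>a\<in>Poly_Mapping.keys p. ?s p a) * mcoeff v k (\<Sum>b\<in>Poly_Mapping.keys q. ?s q b)"
    unfolding sum_product mcoeff_sum ..
  also have "\<dots> = p * mcoeff v k q"
    using mpoly_sum_single[of p] mpoly_sum_single[of q] by simp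
  finally show ?thesis .
qed

lemma mcoeff_mvar_mult:
  fixes p :: "'a::comm_semiring_1 mpoly"
  shows "mcoeff v k (mvar v * p) = (if k = 0 then 0 else mcoeff v (k - 1) p)"
proof -
  let ?s = "\<lambda>r m. Poly_Mapping.single m (Poly_Mapping.lookup r m)"
  have single: "mcoeff v k (mvar v * Poly_Mapping.single m c) =
      (if k = 0 then 0 else mcoeff v (k - 1) (Poly_Mapping.single m c))" for m and c :: 'a
  proof -
    have "Poly_Mapping.single v 1 + m - Poly_Mapping.single v k = m - Poly_Mapping.single v (k - 1)"
      if "k \<noteq> 0"
      using that by (auto simp: poly_mapping_eq_iff fun_eq_iff lookup_add lookup_minus lookup_single when_def)
    then show ?thesis
      by (auto simp: mvar_def mult_single mcoeff_single lookup_add)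
  qed
  have "mcoeff v k (mvar v * p) = mcoeff v k (mvar v * (\<Sum>m\<in>Poly_Mapping.keys p. ?s p m))"
    using mpoly_sum_single[of p] by simp
  also have "\<dots> = (if k = 0 then 0 else mcoeff v (k - 1) (\<Sum>m\<in>Poly_Mapping.keys p. ?s p m))"
    by (simp add: sum_distrib_left mcoeff_sum single)
  also have "\<dots> = (if k = 0 then 0 else mcoeff v (k - 1) p)"
    using mpoly_sum_single[of p] by simp
  finally show ?thesis .
qed

text \<open>Extraction of the coefficient of one monomial in the variables of \<open>S\<close>.
  These operators index the rows and columns of the coefficient matrix; adding one variable at a
  time fits the induction over matched pairs.\<close>

inductive coeff_op :: "nat set \<Rightarrow> ('a::zero mpoly \<Rightarrow> 'a mpoly) \<Rightarrow> bool" where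
  empty: "coeff_op {} (\<lambda>p. p)"
| insert: "coeff_op S \<phi> \<Longrightarrow> v \<notin> S \<Longrightarrow> coeff_op (insert v S) (\<lambda>p. \<phi> (mcoeff v k p))"

lemma coeff_op_0: "coeff_op S \<phi> \<Longrightarrow> \<phi> 0 = 0"
  by (induction rule: coeff_op.induct) auto

lemma coeff_op_sum: "coeff_op S \<phi> \<Longrightarrow> \<phi> (sum p K) = (\<Sum>i\<in>K. \<phi> (p i))"
  by (induction arbitrary: p rule: coeff_op.induct) (auto simp: mcoeff_sum)

lemma coeff_op_in_mpolys_in: "coeff_op S \<phi> \<Longrightarrow> p \<in> mpolys_in T \<Longrightarrow> \<phi> p \<in> mpolys_in (T - S)"
proof (induction arbitrary: p T rule: coeff_op.induct)
  case (insert S \<phi> v k)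
  then have "\<phi> (mcoeff v k p) \<in> mpolys_in (T - {v} - S)"
    by (blast intro: mcoeff_in_mpolys_in)
  moreover have "T - {v} - S = T - insert v S"
    by blast
  ultimately show ?case
    by simp
qed auto

lemma coeff_op_mult_left:
  fixes p q :: "'a::comm_semiring_1 mpoly"
  shows "coeff_op S \<phi> \<Longrightarrow> p \<in> mpolys_in (- S) \<Longrightarrow> \<phi> (p * q) = p * \<phi> q"
proof (induction arbitrary: q rule: coeff_op.induct)
  case (insert S \<phi> v k)
  have "p \<in> mpolys_in (- {v})" "p \<in> mpolys_in (- S)"
    using insert.prems by (auto elim: mpolys_in_mono)
  with insert.IH show ?case
    by (simp add: mcoeff_mult_left)
qed auto

text \<open>Lets a row extraction pass a column operator and reach the linear factor.\<close>

lemma coeff_op_mcoeff_commute: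
  "coeff_op S \<phi> \<Longrightarrow> v \<notin> S \<Longrightarrow> \<phi> (mcoeff v k p) = mcoeff v k (\<phi> p)"
  by (induction arbitrary: p rule: coeff_op.induct) (auto simp: mcoeff_commute[of _ v])

lemma finite_mcoeff_neq_0: "finite {k. mcoeff v k p \<noteq> 0}"
proof (rule finite_subset)
  show "{k. mcoeff v k p \<noteq> 0} \<subseteq> (\<lambda>m. Poly_Mapping.lookup m v) ` Poly_Mapping.keys p"
  proof
    fix k assume "k \<in> {k. mcoeff v k p \<noteq> 0}"
    then obtain m where "Poly_Mapping.lookup (mcoeff v k p) m \<noteq> 0"
      by (auto simp: poly_mapping_eq_iff fun_eq_iff)
    then have "m + Poly_Mapping.single v k \<in> Poly_Mapping.keys p"
      "Poly_Mapping.lookup (m + Poly_Mapping.single v k) v = k"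
      by (auto simp: lookup_mcoeff lookup_add in_keys_iff split: if_splits)
    then show "k \<in> (\<lambda>m. Poly_Mapping.lookup m v) ` Poly_Mapping.keys p"
      by force
  qed
qed simp

lemma ex_mcoeff_neq_0:
  assumes "p \<noteq> 0"
  shows "\<exists>k. mcoeff v k p \<noteq> 0"
proof -
  from assms obtain m where m: "Poly_Mapping.lookup p m \<noteq> 0"
    by (auto simp: poly_mapping_eq_iff fun_eq_iff)
  define k where "k = Poly_Mapping.lookup m v"
  have "m - Poly_Mapping.single v k + Poly_Mapping.single v k = m"
    by (auto simp: k_def poly_mapping_eq_iff fun_eq_iff lookup_add lookup_minus lookup_single when_def)
  then have "Poly_Mapping.lookup (mcoeff v k p) (m - Poly_Mapping.single v k) \<noteq> 0"
    using m by (simp add: lookup_mcoeff lookup_minus k_def)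
  then show ?thesis
    by (metis lookup_zero)
qed

text \<open>The linear factor raises one of the two exponents or neither. Zero exponents are
  separate cases because \<open>0 - 1 = 0\<close> on naturals.\<close>

lemma mcoeff_mcoeff_linear_mult:
  fixes p :: "'a::comm_semiring_1 mpoly"
  assumes "x \<noteq> y"
  shows "mcoeff x a (mcoeff y b ((mvar x + mvar y + mconst c) * p)) =
    (if a = 0 then 0 else mcoeff x (a - 1) (mcoeff y b p)) +
    (if b = 0 then 0 else mcoeff x a (mcoeff y (b - 1) p)) +
    mconst c * mcoeff x a (mcoeff y b p)"
proof -
  have "mcoeff y b (mvar x * p) = mvar x * mcoeff y b p"
    using assms by (intro mcoeff_mult_left mvar_in_mpolys_in) auto
  moreover have "mcoeff v k (mconst c * q) = mconst c * mcoeff v k q" for v k q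
    by (intro mcoeff_mult_left) simp
  ultimately show ?thesis
    by (simp add: distrib_right mcoeff_add mcoeff_mvar_mult)
qed

section \<open>Multiples of a product over a matching\<close>

text \<open>The witnesses are the lexicographically smallest and largest monomials of the
  top-degree component with respect to \<open>x\<close> and \<open>y\<close>: of \<open>G\<close> itself, shifted by the
  extreme terms \<open>y\<close> and \<open>x\<close> of the linear factor.\<close>
lemma mcoeff_linear_mult_corners:
  fixes G :: "'a::comm_semiring_1 mpoly" and \<beta> :: 'a
  assumes "G \<noteq> 0" and xy: "x \<noteq> y"
  defines "c \<equiv> \<lambda>a b p. mcoeff x a (mcoeff y b p)"
  defines "L \<equiv> (mvar x + mvar y + mconst \<beta>) * G"
  shows "\<exists>a b a' b'. c a b L \<noteq> 0 \<and> c a' b' L \<noteq> 0 \<and> c a' b L = 0"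
proof -
  define K where "K = {(a, b). c a b G \<noteq> 0}"
  have "K \<subseteq> {a. mcoeff x a G \<noteq> 0} \<times> {b. mcoeff y b G \<noteq> 0}"
  proof safe
    fix a b assume "(a, b) \<in> K"
    then have "c a b G \<noteq> 0" and "c a b G = mcoeff y b (mcoeff x a G)"
      by (simp_all add: K_def c_def mcoeff_commute[OF xy])
    then show "mcoeff x a G = 0 \<Longrightarrow> False" "mcoeff y b G = 0 \<Longrightarrow> False"
      by (auto simp: c_def)
  qed
  then have finK: "finite K"
    by (rule finite_subset) (intro finite_cartesian_product finite_mcoeff_neq_0)
  have "K \<noteq> {}"
    using ex_mcoeff_neq_0[OF \<open>G \<noteq> 0\<close>, of y] ex_mcoeff_neq_0[of _ x] by (fastforce simp: K_def c_def)
  \<comment> \<open>The top total degree in \<open>x\<close> and \<open>y\<close>, coefficients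
    being polynomials in the other variables. \<open>T\<close> below collects the
    \<open>x\<close>-exponents occurring in that degree.\<close>
  define d where "d = Max ((\<lambda>(a, b). a + b) ` K)"
  have d0: "c a b G = 0" if "a + b > d" for a b
  proof (rule ccontr)
    assume "c a b G \<noteq> 0"
    then have "a + b \<in> (\<lambda>(a, b). a + b) ` K"
      by (force simp: K_def)
    then have "a + b \<le> d"
      unfolding d_def using finK by (intro Max_ge) simp_all
    with that show False
      by simp
  qed
  have "d \<in> (\<lambda>(a, b). a + b) ` K"
    unfolding d_def using finK \<open>K \<noteq> {}\<close> by (intro Max_in) auto
  then obtain a0 b0 where "a0 + b0 = d" "c a0 b0 G \<noteq> 0"
    by (auto simp: K_def)
  define T where "T = {a. a \<le> d \<and> c a (d - a) G \<noteq> 0}"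
  have "a0 \<in> T" and finT: "finite T"
    using \<open>a0 + b0 = d\<close> \<open>c a0 b0 G \<noteq> 0\<close> by (auto simp: T_def)
  then have "T \<noteq> {}"
    by blast
  define lo hi where "lo = Min T" and "hi = Max T"
  have "lo \<in> T" "hi \<in> T" "lo \<le> hi"
    using finT \<open>T \<noteq> {}\<close> by (auto simp: lo_def hi_def)
  have lo: "c lo (d - lo) G \<noteq> 0" "lo \<le> d" and hi: "c hi (d - hi) G \<noteq> 0" "hi \<le> d"
    using \<open>lo \<in> T\<close> \<open>hi \<in> T\<close> by (auto simp: T_def)
  have below: "c a (d - a) G = 0" if "a < lo" for a
    using that Min_le[OF finT, of a] lo by (fastforce simp: T_def lo_def)
  have above: "c a (d - a) G = 0" if "a > hi" "a \<le> d" for a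
    using that Max_ge[OF finT, of a] by (fastforce simp: T_def hi_def)
  have cL: "c a b L = (if a = 0 then 0 else c (a - 1) b G) + (if b = 0 then 0 else c a (b - 1) G)
      + mconst \<beta> * c a b G" for a b
    unfolding c_def L_def by (rule mcoeff_mcoeff_linear_mult[OF xy])
  \<comment> \<open>In total degree \<open>d + 1\<close> the constant contributes nothing, and
    raising \<open>x\<close> would start from an exponent below \<open>lo\<close>; only raising
    \<open>y\<close> remains. The argument for \<open>hi\<close> is symmetric.\<close>
  have "c (lo - 1) (Suc (d - lo)) G = 0" if "lo > 0"
    using below[of "lo - 1"] that lo by (simp add: Suc_diff_le[symmetric])
  then have "c lo (Suc (d - lo)) L = c lo (d - lo) G"
    using lo by (auto simp: cL d0)
  moreover have "c (Suc hi) (d - hi - 1) G = 0" if "d - hi > 0"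
    using above[of "Suc hi"] that by simp
  then have "c (Suc hi) (d - hi) L = c hi (d - hi) G"
    using hi by (auto simp: cL d0)
  \<comment> \<open>Here every contribution would come from total degree above \<open>d\<close> in
    \<open>G\<close>.\<close>
  moreover have "c (Suc hi) (Suc (d - lo)) L = 0"
    using lo \<open>lo \<le> hi\<close> by (auto simp: cL d0)
  ultimately show ?thesis
    using lo hi by metis
qed

text \<open>Induction over matched pairs, for all \<open>G\<close>. The two corners of the new
  factor supply two new cofactors in place of \<open>G\<close>; their families are concatenated, and
  the vanishing mixed coefficient gives the zero block below the diagonal.\<close>

lemma triangular_coeff_ops:
  fixes G :: "'a::idom mpoly" and \<beta> :: "nat \<Rightarrow> 'a"
  assumes "finite X" "inj_on \<pi> X" "X \<inter> \<pi> ` X = {}" "G \<noteq> 0"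
  defines "h \<equiv> \<lambda>G. (\<Prod>i\<in>X. mvar i + mvar (\<pi> i) + mconst (\<beta> i)) * G"
  shows "\<exists>(f :: nat \<Rightarrow> _) (e :: nat \<Rightarrow> _). (\<forall>s < 2 ^ card X. coeff_op X (f s) \<and> coeff_op (\<pi> ` X) (e s) \<and> f s (e s (h G)) \<noteq> 0) \<and>
               (\<forall>s < 2 ^ card X. \<forall>t < s. f s (e t (h G)) = 0)"
  using assms(1-4) unfolding h_def
proof (induction X arbitrary: G rule: finite_induct)
  case empty
  have "coeff_op {} ((\<lambda>_ p. p) (0::nat) :: 'a mpoly \<Rightarrow> 'a mpoly)"
    by (simp add: coeff_op.empty)
  then show ?case
    using empty by (intro exI[of _ "\<lambda>_ p. p"]) simp
next
  case (insert x X)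
  define y where "y = \<pi> x"
  define P :: "'a mpoly" where "P = (\<Prod>i\<in>X. mvar i + mvar (\<pi> i) + mconst (\<beta> i))"
  define N :: nat where "N = 2 ^ card X"
  have xy: "x \<noteq> y" and "y \<notin> \<pi> ` X" "x \<notin> \<pi> ` X" "y \<notin> X"
    using insert.prems insert.hyps by (auto simp: y_def)
  have P: "P \<in> mpolys_in (- {v})" if "v \<notin> X" "v \<notin> \<pi> ` X" for v
    using that unfolding P_def
    by (intro mpolys_in_prod mpolys_in_add mvar_in_mpolys_in mconst_in_mpolys_in) auto
  let ?c = "\<lambda>a b p. mcoeff x a (mcoeff y b p)"
  let ?L = "(mvar x + mvar y + mconst (\<beta> x)) * G"
  have prod_eq: "(\<Prod>i\<in>insert x X. mvar i + mvar (\<pi> i) + mconst (\<beta> i)) * G = P * ?L"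
    using insert.hyps by (simp add: P_def y_def ac_simps)
  \<comment> \<open>The remaining factors avoid \<open>x\<close> and \<open>y\<close>, so extraction
    passes them.\<close>
  have cP: "?c a b (P * q) = P * ?c a b q" for a b q
    using P insert.hyps \<open>y \<notin> \<pi> ` X\<close> \<open>x \<notin> \<pi> ` X\<close> \<open>y \<notin> X\<close> by (simp add: mcoeff_mult_left)
  obtain a b a' b' where c1: "?c a b ?L \<noteq> 0" and c2: "?c a' b' ?L \<noteq> 0" and c3: "?c a' b ?L = 0"
    using mcoeff_linear_mult_corners[OF insert.prems(3) xy] by blast
  have IH: "\<exists>f e. (\<forall>s<N. coeff_op X (f s) \<and> coeff_op (\<pi> ` X) (e s) \<and> f s (e s (P * G)) \<noteq> 0) \<and>
               (\<forall>s<N. \<forall>t<s. f s (e t (P * G)) = 0)" if "G \<noteq> 0" for G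
    using insert.IH[of G] insert.prems that unfolding N_def P_def by auto
  obtain f1 e1 where
      F1: "\<forall>s<N. coeff_op X (f1 s) \<and> coeff_op (\<pi> ` X) (e1 s) \<and> f1 s (e1 s (P * ?c a b ?L)) \<noteq> 0"
      and T1: "\<forall>s<N. \<forall>t<s. f1 s (e1 t (P * ?c a b ?L)) = 0"
    using IH[OF c1] by (elim exE conjE)
  have 1: "coeff_op X (f1 s)" "coeff_op (\<pi> ` X) (e1 s)" "f1 s (e1 s (P * ?c a b ?L)) \<noteq> 0"
    if "s < N" for s
    using F1 that by simp_all
  obtain f2 e2 where
      F2: "\<forall>s<N. coeff_op X (f2 s) \<and> coeff_op (\<pi> ` X) (e2 s) \<and> f2 s (e2 s (P * ?c a' b' ?L)) \<noteq> 0"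
      and T2: "\<forall>s<N. \<forall>t<s. f2 s (e2 t (P * ?c a' b' ?L)) = 0"
    using IH[OF c2] by (elim exE conjE)
  have 2: "coeff_op X (f2 s)" "coeff_op (\<pi> ` X) (e2 s)" "f2 s (e2 s (P * ?c a' b' ?L)) \<noteq> 0"
    if "s < N" for s
    using F2 that by simp_all
  \<comment> \<open>Indices below \<open>N\<close> use the corner \<open>(a, b)\<close>, the others,
    shifted by \<open>N\<close>, use \<open>(a', b')\<close>.\<close>
  define f where "f = (\<lambda>s p. if s < N then f1 s (mcoeff x a p) else f2 (s - N) (mcoeff x a' p))"
  define e where "e = (\<lambda>s p. if s < N then e1 s (mcoeff y b p) else e2 (s - N) (mcoeff y b' p))"
  have N: "2 ^ card (insert x X) = N + N"
    using insert.hyps by (simp add: N_def)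
  have swap: "mcoeff x k (\<phi> (mcoeff y l p)) = \<phi> (?c k l p)" if "coeff_op (\<pi> ` X) \<phi>" for k l p \<phi>
    using coeff_op_mcoeff_commute[OF that \<open>x \<notin> \<pi> ` X\<close>] by simp
  have "coeff_op (insert x X) (f s)" if "s < N + N" for s
    using that insert.hyps by (cases "s < N") (auto simp: f_def intro!: coeff_op.insert 1 2)
  moreover have "coeff_op (\<pi> ` insert x X) (e s)" if "s < N + N" for s
    using that \<open>y \<notin> \<pi> ` X\<close>
    by (cases "s < N") (auto simp: e_def y_def[symmetric] intro!: coeff_op.insert 1 2)
  moreover have "f s (e s (P * ?L)) \<noteq> 0" if "s < N + N" for s
    using that 1 2 by (cases "s < N") (simp_all add: f_def e_def swap cP)
  moreover have "f s (e t (P * ?L)) = 0" if "s < N + N" "t < s" for s t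
  proof -
    consider "s < N" | "t \<ge> N" | "t < N" "s \<ge> N"
      by linarith
    then show ?thesis
    proof cases
      \<comment> \<open>The lower left block: row exponent \<open>a'\<close> meets column exponent
        \<open>b\<close>, so \<open>c3\<close> applies.\<close>
      case 3
      have "e1 t 0 = 0" "f2 (s - N) 0 = 0"
        using that 3 coeff_op_0[OF 1(2)] coeff_op_0[OF 2(1)] by auto
      with that 3 show ?thesis
        using 1(2)[of t] by (simp add: f_def e_def swap cP c3)
    qed (use that 1 2 T1 T2 in \<open>simp_all add: f_def e_def swap cP\<close>)
  qed
  ultimately show ?case
    unfolding prod_eq N by blast
qed

section \<open>Rank over an integral domain\<close>

text \<open>Gaussian elimination without division, since the entries will be polynomials.\<close>

lemma ex_linear_dependence:
  fixes u :: "'i \<Rightarrow> 'k \<Rightarrow> 'a::idom"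
  assumes "finite K" "finite I" "card K < card I"
  shows "\<exists>c. (\<exists>i\<in>I. c i \<noteq> 0) \<and> (\<forall>k\<in>K. (\<Sum>i\<in>I. c i * u i k) = 0)"
  using assms
proof (induction K arbitrary: I u rule: finite_induct)
  case empty
  then have "I \<noteq> {}"
    by auto
  then show ?case
    by (intro exI[of _ "\<lambda>_. 1"]) auto
next
  case (insert k K)
  show ?case
  proof (cases "\<forall>i\<in>I. u i k = 0")
    case True
    then show ?thesis
      using insert.IH[of I u] insert.prems insert.hyps by simp
  next
    case False
    then obtain j where j: "j \<in> I" "u j k \<noteq> 0"
      by blast
    \<comment> \<open>Cross-multiplying with the pivot row \<open>j\<close> clears column
      \<open>k\<close>.\<close>
    define w where "w = (\<lambda>i l. u j k * u i l - u i k * u j l)"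
    have "card K < card (I - {j})"
      using insert.prems insert.hyps j by simp
    then obtain c where c: "\<exists>i\<in>I - {j}. c i \<noteq> 0" "\<forall>l\<in>K. (\<Sum>i\<in>I - {j}. c i * w i l) = 0"
      using insert.IH[of "I - {j}" w] insert.prems by auto
    \<comment> \<open>The coefficient at \<open>j\<close> collects the multiples of the pivot row. A
      nonzero \<open>c i\<close> stays nonzero after scaling by the pivot, as there are no zero
      divisors.\<close>
    define c' where "c' = (\<lambda>i. if i = j then - (\<Sum>i\<in>I - {j}. c i * u i k) else c i * u j k)"
    have "(\<Sum>i\<in>I. c' i * u i l) = (\<Sum>i\<in>I - {j}. c i * w i l)" for l
    proof -
      have "(\<Sum>i\<in>I. c' i * u i l) = c' j * u j l + (\<Sum>i\<in>I - {j}. c' i * u i l)"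
        using j insert.prems by (simp add: sum.remove)
      also have "(\<Sum>i\<in>I - {j}. c' i * u i l) = (\<Sum>i\<in>I - {j}. c i * u j k * u i l)"
        by (rule sum.cong) (auto simp: c'_def)
      also have "c' j * u j l + \<dots> = (\<Sum>i\<in>I - {j}. c i * w i l)"
        by (simp add: c'_def w_def sum_distrib_left sum_subtractf algebra_simps)
      finally show ?thesis .
    qed
    moreover have "w i k = 0" for i
      by (simp add: w_def)
    moreover have "\<exists>i\<in>I. c' i \<noteq> 0"
      using c(1) j by (auto simp: c'_def)
    ultimately show ?thesis
      using c(2) by (intro exI[of _ c']) auto
  qed
qed

text \<open>A dependence between the rows of \<open>u\<close> would carry over to the rows of the
  product, which the nonzero diagonal forbids.\<close>

lemma triangular_rank_le:
  fixes u :: "nat \<Rightarrow> 'k \<Rightarrow> 'a::idom"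
  assumes "finite K"
    and diag: "\<And>s. s < N \<Longrightarrow> (\<Sum>k\<in>K. u s k * v k s) \<noteq> 0"
    and below: "\<And>s t. s < N \<Longrightarrow> t < s \<Longrightarrow> (\<Sum>k\<in>K. u s k * v k t) = 0"
  shows "N \<le> card K"
proof (rule ccontr)
  assume "\<not> N \<le> card K"
  then obtain c where "\<exists>s\<in>{..<N}. c s \<noteq> 0" and c: "\<forall>k\<in>K. (\<Sum>s<N. c s * u s k) = 0"
    using ex_linear_dependence[of K "{..<N}" u] \<open>finite K\<close> by auto
  then have ex: "\<exists>s. s < N \<and> c s \<noteq> 0"
    by auto
  \<comment> \<open>In column \<open>t\<close> the rows before \<open>t\<close> have coefficient 0
    by minimality and those after it have entry 0, so only the diagonal term survives.\<close>
  define t where "t = (LEAST s. s < N \<and> c s \<noteq> 0)"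
  have t: "t < N" "c t \<noteq> 0"
    using LeastI_ex[OF ex] by (auto simp: t_def)
  have least: "c s = 0" if "s < t" for s
    using not_less_Least[of s "\<lambda>s. s < N \<and> c s \<noteq> 0"] that t by (auto simp: t_def)
  have "0 = (\<Sum>k\<in>K. (\<Sum>s<N. c s * u s k) * v k t)"
    using c by simp
  also have "\<dots> = (\<Sum>k\<in>K. \<Sum>s<N. c s * (u s k * v k t))"
    by (simp add: sum_distrib_right mult.assoc)
  also have "\<dots> = (\<Sum>s<N. c s * (\<Sum>k\<in>K. u s k * v k t))"
    by (subst sum.swap) (simp add: sum_distrib_left)
  also have "\<dots> = (\<Sum>s\<in>{t}. c s * (\<Sum>k\<in>K. u s k * v k t))"
  proof (rule sum.mono_neutral_right)
    show "\<forall>s\<in>{..<N} - {t}. c s * (\<Sum>k\<in>K. u s k * v k t) = 0"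
      using least below by (metis DiffE insertI1 lessThan_iff linorder_neqE_nat mult_zero_left mult_zero_right)
  qed (use t in auto)
  finally show False
    using t diag[of t] by simp
qed

text \<open>Each \<open>p k * q k\<close> contributes an outer product, of rank at most one, to the
  coefficient matrix, whose triangular submatrix has size \<open>2 ^ card X\<close>.\<close>

lemma matching_multiple_rank_ge:
  fixes G :: "'a::idom mpoly" and \<beta> :: "nat \<Rightarrow> 'a"
  assumes X: "finite X" "inj_on \<pi> X" "X \<inter> \<pi> ` X = {}" and "G \<noteq> 0" and "finite K"
    and p: "\<And>k. k \<in> K \<Longrightarrow> p k \<in> mpolys_in (- \<pi> ` X)"
    and q: "\<And>k. k \<in> K \<Longrightarrow> q k \<in> mpolys_in (- X)"
    and eq: "(\<Prod>i\<in>X. mvar i + mvar (\<pi> i) + mconst (\<beta> i)) * G = (\<Sum>k\<in>K. p k * q k)"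
  shows "2 ^ card X \<le> card K"
proof -
  let ?h = "(\<Prod>i\<in>X. mvar i + mvar (\<pi> i) + mconst (\<beta> i)) * G"
  obtain f e :: "nat \<Rightarrow> 'a mpoly \<Rightarrow> 'a mpoly" where
      diag: "\<forall>s < 2 ^ card X. coeff_op X (f s) \<and> coeff_op (\<pi> ` X) (e s) \<and> f s (e s ?h) \<noteq> 0"
      and below: "\<forall>s < 2 ^ card X. \<forall>t < s. f s (e t ?h) = 0"
    using triangular_coeff_ops[OF X \<open>G \<noteq> 0\<close>, of \<beta>] by (elim exE conjE)
  have fe: "coeff_op X (f s)" "coeff_op (\<pi> ` X) (e s)" "f s (e s ?h) \<noteq> 0"
    if "s < 2 ^ card X" for s
    using diag that by simp_all
  have split: "f s (e t ?h) = (\<Sum>k\<in>K. f s (p k) * e t (q k))"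
    if "s < 2 ^ card X" "t < 2 ^ card X" for s t
  proof -
    have "f s (e t (p k * q k)) = f s (p k) * e t (q k)" if "k \<in> K" for k
    proof -
      \<comment> \<open>The column operator acts first: it passes \<open>p k\<close> and leaves of
        \<open>q k\<close> a polynomial still free of \<open>X\<close>, a scalar for the row
        operator.\<close>
      have "e t (q k) \<in> mpolys_in (- X)"
        using coeff_op_in_mpolys_in[OF fe(2) q] that \<open>t < _\<close> by (blast intro: mpolys_in_mono)
      then have "f s (e t (q k) * p k) = e t (q k) * f s (p k)"
        by (rule coeff_op_mult_left[OF fe(1)[OF \<open>s < _\<close>]])
      moreover have "e t (p k * q k) = p k * e t (q k)"
        by (rule coeff_op_mult_left[OF fe(2)[OF \<open>t < _\<close>] p[OF that]])
      ultimately show ?thesis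
        by (simp add: mult.commute)
    qed
    then show ?thesis
      using that by (simp add: eq coeff_op_sum[OF fe(2)] coeff_op_sum[OF fe(1)])
  qed
  show ?thesis
  proof (rule triangular_rank_le)
    fix s t :: nat assume "s < 2 ^ card X" "t < s"
    then show "(\<Sum>k\<in>K. f s (p k) * e t (q k)) = 0"
      using split[of s t] below by simp
  qed (use split fe(3) \<open>finite K\<close> in auto)
qed

section \<open>Cutting a branching program\<close>

text \<open>Entries of products of the transfer matrices between consecutive layers;
  \<open>l\<close> is carried along so that successors range over one layer.\<close>

fun walk_sum :: "('v, 'a::comm_ring_1) abp \<Rightarrow> nat \<Rightarrow> nat \<Rightarrow> 'v \<Rightarrow> 'v \<Rightarrow> 'a mpoly" where
  "walk_sum B l 0 u v = (if u = v then 1 else 0)"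
| "walk_sum B l (Suc k) u v = (\<Sum>w\<in>{w \<in> layer B (Suc l). (u, w) \<in> edges B}.
     label B (u, w) * walk_sum B (Suc l) k w v)"

context
  fixes n r :: nat and B :: "('v, 'a::comm_ring_1) abp"
  assumes B: "read_twice_oblivious_abp n r B"
begin

lemma layer_0: "layer B 0 = {source B}"
  and layer_last: "layer B (2 * n) = {sink B}"
  and finite_layer: "l \<le> 2 * n \<Longrightarrow> finite (layer B l)"
  and card_layer: "l \<le> 2 * n \<Longrightarrow> card (layer B l) \<le> r"
  and card_reads: "i \<in> {1..n} \<Longrightarrow> card {l \<in> {1..2 * n}. read_var B l = i} = 2"
  using B by (auto simp: read_twice_oblivious_abp_def)

lemma layer_unique:
  assumes "u \<in> layer B l" "u \<in> layer B l'" "l \<le> 2 * n" "l' \<le> 2 * n"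
  shows "l = l'"
proof -
  have "disjoint_family_on (layer B) {0..2 * n}"
    using B by (simp add: read_twice_oblivious_abp_def)
  with assms show ?thesis
    unfolding disjoint_family_on_def by (metis IntI atLeastAtMost_iff empty_iff zero_le)
qed

lemma edge_layer:
  assumes "(u, v) \<in> edges B" "u \<in> layer B l" "l \<le> 2 * n"
  shows "l < 2 * n \<and> v \<in> layer B (Suc l)"
proof -
  have "edges B \<subseteq> (\<Union>l\<in>{1..2 * n}. layer B (l - 1) \<times> layer B l)"
    using B by (simp add: read_twice_oblivious_abp_def)
  with assms obtain k where k: "k \<in> {1..2 * n}" "u \<in> layer B (k - 1)" "v \<in> layer B k"
    by blast
  then have "l = k - 1"
    using assms by (intro layer_unique[of u]) auto
  with k show ?thesis
    by auto
qed

lemma label_in_mpolys_in: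
  assumes "(u, v) \<in> edges B" "u \<in> layer B l" "l \<le> 2 * n"
  shows "label B (u, v) \<in> mpolys_in {read_var B (Suc l)}"
proof -
  have "\<forall>l\<in>{1..2 * n}. \<forall>e\<in>edges B \<inter> layer B (l - 1) \<times> layer B l. label B e \<in> mpolys_in {read_var B l}"
    using B by (simp add: read_twice_oblivious_abp_def)
  from bspec[OF this, of "Suc l"] edge_layer[OF assms] assms show ?thesis
    by auto
qed

lemma walk_sum_in_mpolys_in:
  assumes "l + k \<le> 2 * n" "u \<in> layer B l"
  shows "walk_sum B l k u v \<in> mpolys_in (read_var B ` {l<..l + k})"
  using assms
proof (induction k arbitrary: l u)
  case (Suc k)
  have "label B (u, w) * walk_sum B (Suc l) k w v \<in> mpolys_in (read_var B ` {l<..l + Suc k})"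
    if w: "w \<in> layer B (Suc l)" "(u, w) \<in> edges B" for w
  proof (rule mpolys_in_mult)
    show "label B (u, w) \<in> mpolys_in (read_var B ` {l<..l + Suc k})"
      using label_in_mpolys_in[of u w l] w Suc.prems by (auto elim!: mpolys_in_mono)
    show "walk_sum B (Suc l) k w v \<in> mpolys_in (read_var B ` {l<..l + Suc k})"
      using Suc.IH[of "Suc l" w] w Suc.prems by (auto elim!: mpolys_in_mono)
  qed
  then show ?case
    by (auto intro: mpolys_in_sum)
qed simp

text \<open>Matrix multiplication: a walk meets layer \<open>l + j\<close> in exactly one
  vertex.\<close>

lemma walk_sum_add:
  assumes "l + j \<le> 2 * n" "u \<in> layer B l"
  shows "walk_sum B l (j + k) u v = (\<Sum>w\<in>layer B (l + j). walk_sum B l j u w * walk_sum B (l + j) k w v)"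
  using assms
proof (induction j arbitrary: l u)
  case 0
  have "(\<Sum>w\<in>layer B l. walk_sum B l 0 u w * walk_sum B l k w v) =
      (\<Sum>w\<in>layer B l. if w = u then walk_sum B l k w v else 0)"
    by (rule sum.cong) auto
  then show ?case
    using 0 finite_layer[of l] by (simp add: sum.delta)
next
  case (Suc j)
  let ?N = "{w \<in> layer B (Suc l). (u, w) \<in> edges B}"
  have "walk_sum B l (Suc j + k) u v =
      (\<Sum>w\<in>?N. \<Sum>w'\<in>layer B (l + Suc j). label B (u, w) * walk_sum B (Suc l) j w w' * walk_sum B (l + Suc j) k w' v)"
    using Suc by (auto simp: sum_distrib_left mult.assoc intro!: sum.cong)
  also have "\<dots> = (\<Sum>w'\<in>layer B (l + Suc j). walk_sum B l (Suc j) u w' * walk_sum B (l + Suc j) k w' v)"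
    by (subst sum.swap) (simp add: sum_distrib_right)
  finally show ?case .
qed

text \<open>Connects sums over vertex lists with the recursion. Finiteness is part of the induction
  because splitting by the second vertex uses it.\<close>

lemma sum_walks_eq_walk_sum:
  fixes v :: 'v
  assumes "l + k \<le> 2 * n" "u \<in> layer B l"
  defines "W \<equiv> \<lambda>k u. {vs. length vs = Suc k \<and> hd vs = u \<and> last vs = v \<and>
                           successively (\<lambda>u v. (u, v) \<in> edges B) vs}"
  shows "finite (W k u) \<and>
         (\<Sum>vs\<in>W k u. prod_list (map (label B) (zip vs (tl vs)))) = walk_sum B l k u v"
  using assms(1,2)
proof (induction k arbitrary: l u)
  case 0
  have "W 0 u = (if u = v then {[u]} else {})"
    by (auto simp: W_def length_Suc_conv)
  then show ?case
    by simp
next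
  case (Suc k)
  let ?N = "{w \<in> layer B (Suc l). (u, w) \<in> edges B}"
  let ?p = "\<lambda>vs. prod_list (map (label B) (zip vs (tl vs)))"
  have W: "W (Suc k) u = (\<Union>w\<in>?N. (#) u ` W k w)"
  proof (intro equalityI subsetI)
    fix vs assume "vs \<in> W (Suc k) u"
    then obtain w ws where vs: "vs = u # w # ws" "(u, w) \<in> edges B" "w # ws \<in> W k w"
      by (auto simp: W_def length_Suc_conv)
    then have "w \<in> ?N"
      using edge_layer[of u w l] Suc.prems by simp
    with vs show "vs \<in> (\<Union>w\<in>?N. (#) u ` W k w)"
      by blast
  next
    fix vs assume "vs \<in> (\<Union>w\<in>?N. (#) u ` W k w)"
    then show "vs \<in> W (Suc k) u"
      by (auto simp: W_def length_Suc_conv)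
  qed
  have IH: "finite (W k w)" "(\<Sum>vs\<in>W k w. ?p vs) = walk_sum B (Suc l) k w v" if "w \<in> ?N" for w
    using Suc.IH[of "Suc l" w] Suc.prems that by simp_all
  have fin: "finite ?N"
    using finite_layer[of "Suc l"] Suc.prems by simp
  have "(\<Sum>vs\<in>W (Suc k) u. ?p vs) = (\<Sum>w\<in>?N. \<Sum>vs\<in>(#) u ` W k w. ?p vs)"
    unfolding W by (rule sum.UNION_disjoint) (use fin IH in \<open>auto simp: W_def\<close>)
  also have "\<dots> = (\<Sum>w\<in>?N. \<Sum>vs\<in>W k w. label B (u, w) * ?p vs)"
  proof (rule sum.cong[OF refl])
    fix w
    have "?p (u # vs) = label B (u, w) * ?p vs" if "vs \<in> W k w" for vs
      using that by (cases vs) (auto simp: W_def)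
    then show "(\<Sum>vs\<in>(#) u ` W k w. ?p vs) = (\<Sum>vs\<in>W k w. label B (u, w) * ?p vs)"
      by (simp add: sum.reindex)
  qed
  also have "\<dots> = walk_sum B l (Suc k) u v"
    using IH by (simp add: sum_distrib_left[symmetric])
  finally show ?case
    using fin IH unfolding W by simp
qed

text \<open>\<open>paths\<close> does not fix the length, but every edge advances one layer and the
  sink lies only in the last.\<close>

lemma length_walk_to_sink:
  assumes "successively (\<lambda>u v. (u, v) \<in> edges B) vs" "vs \<noteq> []" "hd vs \<in> layer B l" "l \<le> 2 * n"
    "last vs = sink B"
  shows "length vs + l = Suc (2 * n)"
  using assms
proof (induction vs arbitrary: l)
  case (Cons x vs)
  show ?case
  proof (cases vs)
    case Nil
    then have "l = 2 * n"
      using Cons.prems layer_last by (intro layer_unique[of x]) auto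
    with Nil show ?thesis
      by simp
  next
    case (Cons y ys)
    with Cons.prems have "l < 2 * n \<and> y \<in> layer B (Suc l)"
      by (intro edge_layer[of x]) auto
    with Cons.IH[of "Suc l"] Cons.prems Cons show ?thesis
      by auto
  qed
qed simp

lemma abp_poly_eq_walk_sum: "abp_poly B = walk_sum B 0 (2 * n) (source B) (sink B)"
proof -
  have "paths (edges B) (source B) (sink B) =
      {vs. length vs = Suc (2 * n) \<and> hd vs = source B \<and> last vs = sink B \<and>
           successively (\<lambda>u v. (u, v) \<in> edges B) vs}"
    using length_walk_to_sink[of _ 0] layer_0 by (auto simp: paths_def)
  then show ?thesis
    unfolding abp_poly_def using sum_walks_eq_walk_sum[of 0 "2 * n" "source B" "sink B"] layer_0 by simp
qed

text \<open>\<open>K\<close> consists of the triples of vertices at the three cuts. Edges entering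
  layer \<open>l\<close> read \<open>read_var B l\<close>, hence the half-open intervals.\<close>

lemma abp_poly_cut:
  assumes "c1 \<le> c2" "c2 \<le> c3" "c3 \<le> 2 * n"
  obtains K :: "('v \<times> 'v \<times> 'v) set" and p1 p2 p3 p4 where
    "finite K" "card K \<le> r ^ 3" "abp_poly B = (\<Sum>k\<in>K. p1 k * p2 k * p3 k * p4 k)"
    "\<forall>k\<in>K. p1 k \<in> mpolys_in (read_var B ` {0<..c1})"
    "\<forall>k\<in>K. p2 k \<in> mpolys_in (read_var B ` {c1<..c2})"
    "\<forall>k\<in>K. p3 k \<in> mpolys_in (read_var B ` {c2<..c3})"
    "\<forall>k\<in>K. p4 k \<in> mpolys_in (read_var B ` {c3<..2 * n})"
proof -
  let ?W = "walk_sum B"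
  define K where "K = layer B c1 \<times> layer B c2 \<times> layer B c3"
  have s: "source B \<in> layer B 0"
    using layer_0 by simp
  have cut: "?W l (d - l) u v = (\<Sum>w\<in>layer B c. ?W l (c - l) u w * ?W c (d - c) w v)"
    if "l \<le> c" "c \<le> d" "d \<le> 2 * n" "u \<in> layer B l" for l c d u v
    using walk_sum_add[of l "c - l" u "d - c" v] that by simp
  have "abp_poly B = (\<Sum>(u, v, w)\<in>K. ?W 0 c1 (source B) u * ?W c1 (c2 - c1) u v *
      ?W c2 (c3 - c2) v w * ?W c3 (2 * n - c3) w (sink B))"
    using assms cut[of 0 c1 "2 * n" "source B" "sink B"] s
    by (simp add: abp_poly_eq_walk_sum K_def sum.cartesian_product[symmetric] cut[of c1 c2] cut[of c2 c3]
        sum_distrib_left mult.assoc)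
  moreover have "card K \<le> r ^ 3"
    using assms by (auto simp: K_def card_cartesian_product power3_eq_cube mult.assoc
        intro!: mult_le_mono card_layer)
  moreover have "finite K"
    using assms by (auto simp: K_def intro!: finite_cartesian_product finite_layer)
  moreover have W: "?W l (d - l) u v \<in> mpolys_in (read_var B ` {l<..d})"
    if "l \<le> d" "d \<le> 2 * n" "u \<in> layer B l" for l d u v
    using walk_sum_in_mpolys_in[of l "d - l" u v] that by simp
  ultimately show ?thesis
    using assms s W[of 0 c1]
    by (intro that[of K "\<lambda>(u, v, w). ?W 0 c1 (source B) u" "\<lambda>(u, v, w). ?W c1 (c2 - c1) u v"
          "\<lambda>(u, v, w). ?W c2 (c3 - c2) v w" "\<lambda>(u, v, w). ?W c3 (2 * n - c3) w (sink B)"])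
       (auto simp: K_def case_prod_unfold)
qed

end

section \<open>Width bound for two separated blocks of variables\<close>

text \<open>The coefficient of \<open>mvar i\<close> is 1; for \<open>i = j\<close> it would be 2,
  which is 0 in characteristic 2.\<close>

lemma linear_neq_0:
  fixes c :: "'a::comm_ring_1"
  assumes "i \<noteq> j"
  shows "mvar i + mvar j + mconst c \<noteq> 0"
proof -
  have "Poly_Mapping.single i (1::nat) \<noteq> Poly_Mapping.single j 1" "Poly_Mapping.single i (1::nat) \<noteq> 0"
    using assms by (auto simp: poly_mapping_eq_iff fun_eq_iff lookup_single when_def)
  then have "Poly_Mapping.lookup (mvar i + mvar j + mconst c) (Poly_Mapping.single i 1) = 1"
    by (simp add: mvar_def mconst_def lookup_add lookup_single when_def)
  then show ?thesis
    by auto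
qed

text \<open>Matched pairs are distinct unordered pairs, hence distinct factors of the full product;
  the others multiply to a nonzero \<open>G\<close> in a domain.\<close>

lemma pair_product_factorization:
  fixes \<alpha> :: "nat \<Rightarrow> nat \<Rightarrow> 'a::idom"
  assumes X: "X \<subseteq> {1..n}" "\<pi> ` X \<subseteq> {1..n}" "inj_on \<pi> X" "X \<inter> \<pi> ` X = {}"
  obtains \<beta> G where "G \<noteq> 0"
    "pair_product n \<alpha> = (\<Prod>i\<in>X. mvar i + mvar (\<pi> i) + mconst (\<beta> i)) * G"
proof -
  define P where "P = {(i, j). 1 \<le> i \<and> i < j \<and> j \<le> n}"
  define L :: "nat \<times> nat \<Rightarrow> 'a mpoly" where "L = (\<lambda>(i, j). mvar i + mvar j + mconst (\<alpha> i j))"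
  \<comment> \<open>Sorts each pair, as the factors are indexed by \<open>i < j\<close>.\<close>
  define \<sigma> where "\<sigma> = (\<lambda>i. (min i (\<pi> i), max i (\<pi> i)))"
  have "P \<subseteq> {1..n} \<times> {1..n}"
    by (auto simp: P_def)
  then have finP: "finite P"
    by (rule finite_subset) simp
  have neq: "i \<noteq> \<pi> j" if "i \<in> X" "j \<in> X" for i j
    using that X(4) by blast
  have sub: "\<sigma> ` X \<subseteq> P"
  proof
    fix x assume "x \<in> \<sigma> ` X"
    then obtain i where "i \<in> X" "x = \<sigma> i"
      by blast
    moreover have "i \<noteq> \<pi> i" "i \<in> {1..n}" "\<pi> i \<in> {1..n}"
      using \<open>i \<in> X\<close> X neq by blast+
    ultimately show "x \<in> P"
      by (auto simp: P_def \<sigma>_def min_def max_def)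
  qed
  have inj: "inj_on \<sigma> X"
  proof (rule inj_onI)
    fix i j assume ij: "i \<in> X" "j \<in> X" and "\<sigma> i = \<sigma> j"
    then have "i = j \<or> i = \<pi> j"
      by (auto simp: \<sigma>_def min_def max_def split: if_splits)
    with neq[OF ij] show "i = j"
      by blast
  qed
  have "pair_product n \<alpha> = prod L P"
    by (simp add: pair_product_def L_def P_def)
  also have "\<dots> = prod L (\<sigma> ` X) * prod L (P - \<sigma> ` X)"
    using finP sub by (simp add: prod.subset_diff mult.commute)
  also have "prod L (\<sigma> ` X) =
      (\<Prod>i\<in>X. mvar i + mvar (\<pi> i) + mconst (\<alpha> (min i (\<pi> i)) (max i (\<pi> i))))"
    unfolding prod.reindex[OF inj] by (rule prod.cong) (auto simp: L_def \<sigma>_def min_def max_def)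
  finally show ?thesis
    using finP by (intro that[of "prod L (P - \<sigma> ` X)"])
      (auto simp: L_def P_def linear_neq_0 simp del: prod_zero_iff simp: prod_zero_iff)
qed

text \<open>A flag is true where its segment avoids \<open>Y\<close> and false where it avoids
  \<open>X\<close>, so one statement covers every reading pattern.\<close>

lemma abp_width_ge:
  fixes \<alpha> :: "nat \<Rightarrow> nat \<Rightarrow> 'a::idom" and B :: "('v, 'a) abp"
  assumes B: "read_twice_oblivious_abp n r B" and eq: "abp_poly B = g * pair_product n \<alpha>" and "g \<noteq> 0"
    and c: "c1 \<le> c2" "c2 \<le> c3" "c3 \<le> 2 * n"
    and XY: "X \<subseteq> {1..n}" "Y \<subseteq> {1..n}" "X \<inter> Y = {}" "card X = card Y"
    and s: "(if s1 then Y else X) \<inter> read_var B ` {0<..c1} = {}"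
      "(if s2 then Y else X) \<inter> read_var B ` {c1<..c2} = {}"
      "(if s3 then Y else X) \<inter> read_var B ` {c2<..c3} = {}"
      "(if s4 then Y else X) \<inter> read_var B ` {c3<..2 * n} = {}"
  shows "2 ^ card X \<le> r ^ 3"
proof -
  have fin: "finite X" "finite Y"
    using XY by (auto intro: finite_subset)
  then obtain \<pi> where \<pi>: "bij_betw \<pi> X Y"
    using XY(4) finite_same_card_bij by blast
  then have inj: "inj_on \<pi> X" and img: "\<pi> ` X = Y"
    by (auto simp: bij_betw_def)
  obtain \<beta> G where "G \<noteq> 0"
    and G: "pair_product n \<alpha> = (\<Prod>i\<in>X. mvar i + mvar (\<pi> i) + mconst (\<beta> i)) * G"
    by (rule pair_product_factorization[of X n \<pi> \<alpha>]) (use XY inj img in auto)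
  obtain K :: "('v \<times> 'v \<times> 'v) set" and p1 p2 p3 p4 where K: "finite K" "card K \<le> r ^ 3"
      and sum: "abp_poly B = (\<Sum>k\<in>K. p1 k * p2 k * p3 k * p4 k)"
      and p: "\<forall>k\<in>K. p1 k \<in> mpolys_in (read_var B ` {0<..c1})"
        "\<forall>k\<in>K. p2 k \<in> mpolys_in (read_var B ` {c1<..c2})"
        "\<forall>k\<in>K. p3 k \<in> mpolys_in (read_var B ` {c2<..c3})"
        "\<forall>k\<in>K. p4 k \<in> mpolys_in (read_var B ` {c3<..2 * n})"
    by (rule abp_poly_cut[OF B c])
  \<comment> \<open>Segments avoiding \<open>Y\<close> are gathered in \<open>p\<close>, those
    avoiding \<open>X\<close> in \<open>q\<close>.\<close>
  define p where "p = (\<lambda>k. (if s1 then p1 k else 1) * (if s2 then p2 k else 1) *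
      (if s3 then p3 k else 1) * (if s4 then p4 k else 1))"
  define q where "q = (\<lambda>k. (if s1 then 1 else p1 k) * (if s2 then 1 else p2 k) *
      (if s3 then 1 else p3 k) * (if s4 then 1 else p4 k))"
  have free: "x \<in> mpolys_in (- Z)" if "x \<in> mpolys_in S" "Z \<inter> S = {}" for x :: "'a mpoly" and S Z
    using that by (auto elim!: mpolys_in_mono)
  have p': "p1 k \<in> mpolys_in (- (if s1 then Y else X))" "p2 k \<in> mpolys_in (- (if s2 then Y else X))"
    "p3 k \<in> mpolys_in (- (if s3 then Y else X))" "p4 k \<in> mpolys_in (- (if s4 then Y else X))"
    if "k \<in> K" for k
    using free[OF bspec[OF p(1) that] s(1)] free[OF bspec[OF p(2) that] s(2)]
      free[OF bspec[OF p(3) that] s(3)] free[OF bspec[OF p(4) that] s(4)] by blast+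
  have "2 ^ card X \<le> card K"
  \<comment> \<open>The multiplier \<open>g\<close> joins the cofactor, which only has to be
    nonzero; this is why all nonzero multiples are equally hard.\<close>
  proof (rule matching_multiple_rank_ge[of X \<pi> "g * G" K p q \<beta>])
    show "p k \<in> mpolys_in (- \<pi> ` X)" if "k \<in> K" for k
      unfolding p_def img using p'[OF that] by (intro mpolys_in_mult) auto
    show "q k \<in> mpolys_in (- X)" if "k \<in> K" for k
      unfolding q_def using p'[OF that] by (intro mpolys_in_mult) auto
    have "(\<Prod>i\<in>X. mvar i + mvar (\<pi> i) + mconst (\<beta> i)) * (g * G) = abp_poly B"
      by (simp add: eq G ac_simps)
    also have "\<dots> = (\<Sum>k\<in>K. p k * q k)"
      unfolding sum by (rule sum.cong) (auto simp: p_def q_def ac_simps)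
    finally show "(\<Prod>i\<in>X. mvar i + mvar (\<pi> i) + mconst (\<beta> i)) * (g * G) = (\<Sum>k\<in>K. p k * q k)" .
  qed (use fin inj img XY K \<open>G \<noteq> 0\<close> \<open>g \<noteq> 0\<close> in auto)
  with K show ?thesis
    by linarith
qed

section \<open>Separating two blocks of variables\<close>

text \<open>The set of members read so far grows by at most one per position, from empty to
  \<open>S\<close>, so it has size \<open>h\<close> at some position. Its members, read only once,
  do not recur later.\<close>

lemma split_single_reads:
  fixes \<rho> :: "nat \<Rightarrow> 'i"
  assumes "finite S" and once: "\<And>i. i \<in> S \<Longrightarrow> card {l \<in> {a<..e}. \<rho> l = i} = 1"
    and "h \<le> card S" "a \<le> e"
  obtains c T where "a \<le> c" "c \<le> e" "T \<subseteq> S" "card T = h"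
    "(S - T) \<inter> \<rho> ` {a<..c} = {}" "T \<inter> \<rho> ` {c<..e} = {}"
proof -
  define F where "F = (\<lambda>j. S \<inter> \<rho> ` {a<..a + j})"
  have finF: "finite (F j)" for j
    using \<open>finite S\<close> by (simp add: F_def)
  have step: "F (Suc j) = F j \<union> (S \<inter> {\<rho> (Suc (a + j))})" for j
  proof -
    have "{a<..a + Suc j} = insert (Suc (a + j)) {a<..a + j}"
      by auto
    then show ?thesis
      by (auto simp: F_def)
  qed
  have "card (F j) \<le> card (F (Suc j))" "card (F (Suc j)) \<le> card (F j) + 1" for j
  proof -
    show "card (F j) \<le> card (F (Suc j))"
      using finF by (intro card_mono) (auto simp: step)
    have "card (F (Suc j)) \<le> card (F j) + card (S \<inter> {\<rho> (Suc (a + j))})"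
      unfolding step by (rule card_Un_le)
    also have "card (S \<inter> {\<rho> (Suc (a + j))}) \<le> card {\<rho> (Suc (a + j))}"
      by (intro card_mono) auto
    finally show "card (F (Suc j)) \<le> card (F j) + 1"
      by simp
  qed
  then have steps: "\<forall>j < e - a. \<bar>int (card (F (j + 1))) - int (card (F j))\<bar> \<le> 1"
    by (smt (verit) Suc_eq_plus1 of_nat_1 of_nat_add of_nat_mono)
  have "F (e - a) = S"
  proof -
    have "i \<in> \<rho> ` {a<..e}" if "i \<in> S" for i
    proof -
      have "{l \<in> {a<..e}. \<rho> l = i} \<noteq> {}"
        using once[OF that] by (metis card.empty zero_neq_one)
      then show ?thesis
        by auto
    qed
    then show ?thesis
      using \<open>a \<le> e\<close> by (auto simp: F_def)
  qed
  then obtain j where j: "j \<le> e - a" "card (F j) = h"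
    using nat0_intermed_int_val[OF steps, of "int h"] \<open>h \<le> card S\<close> by (auto simp: F_def)
  have "F j \<inter> \<rho> ` {a + j<..e} = {}"
  proof safe
    fix l assume l: "l \<in> {a + j<..e}" "\<rho> l \<in> F j"
    then obtain l' where l': "l' \<in> {a<..a + j}" "\<rho> l' = \<rho> l" "\<rho> l \<in> S"
      by (auto simp: F_def)
    have "card {l, l'} \<le> card {k \<in> {a<..e}. \<rho> k = \<rho> l}"
      using l l' by (intro card_mono) auto
    with l l' once[of "\<rho> l"] show "\<rho> l \<in> {}"
      by simp
  qed
  then show ?thesis
    using j \<open>a \<le> e\<close> by (intro that[of "a + j" "F j"]) (auto simp: F_def)
qed

text \<open>With \<open>A\<close>, \<open>S\<close>, \<open>C\<close> the indices read twice, once and never in the first half, counting reads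
  gives \<open>card A = card C\<close>. If these are small, almost every index lies in \<open>S\<close>; halving \<open>S\<close> by reading time
  in each half leaves a pair of classes of proportional size read in the pattern \<open>XYYX\<close> or \<open>XYXY\<close>.\<close>
lemma read_twice_separation:
  fixes \<rho> :: "nat \<Rightarrow> nat"
  assumes "n \<ge> 2"
    and range: "\<And>l. l \<in> {1..2 * n} \<Longrightarrow> \<rho> l \<in> {1..n}"
    and twice: "\<And>i. i \<in> {1..n} \<Longrightarrow> card {l \<in> {1..2 * n}. \<rho> l = i} = 2"
  obtains c1 c3 X Y s1 s2 s3 s4 where "c1 \<le> n" "n \<le> c3" "c3 \<le> 2 * n"
    "X \<subseteq> {1..n}" "Y \<subseteq> {1..n}" "X \<inter> Y = {}" "card X = card Y" "3 * n \<le> 100 * card X"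
    "(if s1 then Y else X) \<inter> \<rho> ` {0<..c1} = {}"
    "(if s2 then Y else X) \<inter> \<rho> ` {c1<..n} = {}"
    "(if s3 then Y else X) \<inter> \<rho> ` {n<..c3} = {}"
    "(if s4 then Y else X) \<inter> \<rho> ` {c3<..2 * n} = {}"
proof -
  define R1 where "R1 = (\<lambda>i. {l \<in> {0<..n}. \<rho> l = i})"
  define R2 where "R2 = (\<lambda>i. {l \<in> {n<..2 * n}. \<rho> l = i})"
  have R: "card (R1 i) + card (R2 i) = 2" if "i \<in> {1..n}" for i
  proof -
    have "{l \<in> {1..2 * n}. \<rho> l = i} = R1 i \<union> R2 i"
      by (auto simp: R1_def R2_def)
    moreover have "card (R1 i \<union> R2 i) = card (R1 i) + card (R2 i)"
      by (rule card_Un_disjoint) (auto simp: R1_def R2_def)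
    ultimately show ?thesis
      using twice[OF that] by simp
  qed
  define A where "A = {i \<in> {1..n}. card (R1 i) = 2}"
  define S where "S = {i \<in> {1..n}. card (R1 i) = 1}"
  define C where "C = {i \<in> {1..n}. card (R1 i) = 0}"
  have fin: "finite A" "finite S" "finite C"
    by (auto simp: A_def S_def C_def)
  have ASC: "{1..n} = A \<union> S \<union> C"
  proof -
    have "card (R1 i) = 0 \<or> card (R1 i) = 1 \<or> card (R1 i) = 2" if "i \<in> {1..n}" for i
      using R[OF that] by linarith
    then show ?thesis
      unfolding A_def S_def C_def by blast
  qed
  have disj: "A \<inter> S = {}" "(A \<union> S) \<inter> C = {}"
    by (auto simp: A_def S_def C_def)
  have cards: "card A + card S + card C = n"
  proof -
    have "card A + card S + card C = card (A \<union> S \<union> C)"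
      using fin disj by (simp add: card_Un_disjoint)
    then show ?thesis
      by (simp flip: ASC)
  qed
  have "(\<Sum>i\<in>{1..n}. card (R1 i)) = card (\<Union>i\<in>{1..n}. R1 i)"
    by (rule card_UN_disjoint[symmetric]) (auto simp: R1_def)
  also have "(\<Union>i\<in>{1..n}. R1 i) = {0<..n}"
  proof (intro equalityI subsetI)
    fix l assume "l \<in> {0<..n}"
    then have "\<rho> l \<in> {1..n}" "l \<in> R1 (\<rho> l)"
      using range[of l] by (auto simp: R1_def)
    then show "l \<in> (\<Union>i\<in>{1..n}. R1 i)"
      by blast
  qed (auto simp: R1_def)
  finally have "(\<Sum>i\<in>{1..n}. card (R1 i)) = n"
    by simp
  moreover have "(\<Sum>i\<in>{1..n}. card (R1 i)) = 2 * card A + card S"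
  proof -
    have "(\<Sum>i\<in>{1..n}. card (R1 i)) = (\<Sum>i\<in>A. card (R1 i)) + (\<Sum>i\<in>S. card (R1 i)) + (\<Sum>i\<in>C. card (R1 i))"
      unfolding ASC using fin disj by (simp add: sum.union_disjoint)
    also have "\<dots> = (\<Sum>i\<in>A. 2) + (\<Sum>i\<in>S. 1) + (\<Sum>i\<in>C. 0)"
      by (intro arg_cong2[where f = "(+)"] sum.cong) (auto simp: A_def S_def C_def)
    finally show ?thesis
      by simp
  qed
  ultimately have AC: "card A = card C"
    using cards by linarith
  show ?thesis
  proof (cases "3 * n \<le> 100 * card A")
    case True
    have R2: "R2 i = {}" if "i \<in> A" for i
      using R[of i] that by (auto simp: A_def R2_def)
    \<comment> \<open>Only the middle cut matters: with \<open>c1 = c3 = n\<close> both inner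
      segments are empty.\<close>
    show ?thesis
    proof (rule that[of n n A C True True False False])
      show "(if True then C else A) \<inter> \<rho> ` {0<..n} = {}"
        by (auto simp: C_def R1_def)
      show "(if False then C else A) \<inter> \<rho> ` {n<..2 * n} = {}"
        using R2 by (fastforce simp: R2_def)
    qed (use True AC disj in \<open>auto simp: A_def C_def\<close>)
  next
    case False
    define h where "h = card S div 2"
    have h: "h \<le> card S"
      by (simp add: h_def)
    obtain c1 P where P: "c1 \<le> n" "P \<subseteq> S" "card P = h"
        "(S - P) \<inter> \<rho> ` {0<..c1} = {}" "P \<inter> \<rho> ` {c1<..n} = {}"
      using split_single_reads[of S 0 n \<rho> h] fin h by (auto simp: S_def R1_def)
    have "card {l \<in> {n<..2 * n}. \<rho> l = i} = 1" if "i \<in> S" for i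
      using R[of i] that by (simp add: S_def R2_def)
    then obtain c3 Q where Q: "n \<le> c3" "c3 \<le> 2 * n" "Q \<subseteq> S" "card Q = h"
        "(S - Q) \<inter> \<rho> ` {n<..c3} = {}" "Q \<inter> \<rho> ` {c3<..2 * n} = {}"
      using split_single_reads[of S n "2 * n" \<rho> h] fin h by auto
    have finPQ: "finite P" "finite Q"
      using P Q fin by (auto intro: finite_subset)
    have Ssub: "S \<subseteq> {1..n}"
      by (auto simp: S_def)
    \<comment> \<open>Here \<open>100 * card S > 94 * n\<close> and
      \<open>card S \<le> 4 * m + 1\<close>; for \<open>n \<ge> 2\<close> the slack absorbs the
      rounding in \<open>h\<close>.\<close>
    have big: "3 * n \<le> 100 * m" if "h \<le> 2 * m" for m
    proof -
      have "card S \<le> 2 * h + 1"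
        unfolding h_def by linarith
      then show ?thesis
        using that False cards AC \<open>n \<ge> 2\<close> by linarith
    qed
    have PmQ: "card (P - Q) + card (P \<inter> Q) = h" and QmP: "card (Q - P) + card (P \<inter> Q) = h"
      using card_Int_Diff[OF finPQ(1), of Q] card_Int_Diff[OF finPQ(2), of P] P Q
      by (simp_all add: Int_commute)
    show ?thesis
    \<comment> \<open>\<open>P\<close> is the early part of \<open>S\<close> in the first half,
      \<open>Q\<close> in the second. As \<open>card P = h\<close>, one of \<open>P - Q\<close> and
      \<open>P \<inter> Q\<close> has at least \<open>h / 2\<close> elements; the former leads to
      \<open>XYYX\<close>.\<close>
    proof (cases "h \<le> 2 * card (P - Q)")
      case True
      show ?thesis
      proof (rule that[of c1 c3 "P - Q" "Q - P" True False False True])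
        show "card (P - Q) = card (Q - P)"
          using PmQ QmP by linarith
        show "3 * n \<le> 100 * card (P - Q)"
          by (rule big[OF True])
      qed (use P Q Ssub in auto)
    next
      case False
      \<comment> \<open>Since \<open>card S \<ge> 2 * h\<close>, at least as many indices are late
        in both halves as early in both, which leaves room for \<open>Y\<close> and leads to
        \<open>XYXY\<close>.\<close>
      have "card (P \<union> Q) + card (P \<inter> Q) = 2 * h"
        using card_Un_Int[OF finPQ] P Q by simp
      moreover have "card (S - (P \<union> Q)) + card (P \<union> Q) = card S"
        using card_Int_Diff[OF fin(2), of "P \<union> Q"] P Q by (simp add: Int_absorb1)
      ultimately have "card (P \<inter> Q) \<le> card (S - (P \<union> Q))"
        unfolding h_def by linarith
      then obtain Y where Y: "Y \<subseteq> S - (P \<union> Q)" "card Y = card (P \<inter> Q)"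
        by (meson obtain_subset_with_card_n)
      show ?thesis
      proof (rule that[of c1 c3 "P \<inter> Q" Y True False True False])
        show "3 * n \<le> 100 * card (P \<inter> Q)"
          by (rule big) (use False PmQ in linarith)
      qed (use P Q Ssub Y in auto)
    qed
  qed
qed

text \<open>The constant 1/100 arises because three cuts cost a cube root and the blocks have at
  least \<open>3 * n / 100\<close> variables. For \<open>n = 1\<close> the product is empty, and
  with \<open>g = 1\<close> width 1 suffices.\<close>

theorem corollary6p23:
  fixes \<alpha> :: "nat \<Rightarrow> nat \<Rightarrow> 'a::field"
    and g :: "'a mpoly"
    and B :: "('v, 'a) abp"
    and n r :: nat
  assumes "n \<ge> 2"
    and "g \<in> mpolys_in {1..n}" and "g \<noteq> 0"
    and "read_twice_oblivious_abp n r B"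
    and "abp_poly B = g * pair_product n \<alpha>"
  shows "real r \<ge> 2 powr (real n / 100)"
proof -
  have reads: "read_var B l \<in> {1..n}" if "l \<in> {1..2 * n}" for l
    using assms(4) that by (simp add: read_twice_oblivious_abp_def)
  obtain c1 c3 X Y s1 s2 s3 s4 where c: "c1 \<le> n" "n \<le> c3" "c3 \<le> 2 * n"
    and XY: "X \<subseteq> {1..n}" "Y \<subseteq> {1..n}" "X \<inter> Y = {}" "card X = card Y" and m: "3 * n \<le> 100 * card X"
    and s: "(if s1 then Y else X) \<inter> read_var B ` {0<..c1} = {}"
    "(if s2 then Y else X) \<inter> read_var B ` {c1<..n} = {}"
    "(if s3 then Y else X) \<inter> read_var B ` {n<..c3} = {}"
    "(if s4 then Y else X) \<inter> read_var B ` {c3<..2 * n} = {}"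
    by (rule read_twice_separation[OF \<open>n \<ge> 2\<close> reads card_reads[OF assms(4)]])
  have le: "2 ^ card X \<le> r ^ 3"
    by (rule abp_width_ge[OF assms(4,5,3) c XY s])
  then have "r > 0"
    by (cases "r = 0") auto
  have "2 powr (real n / 100) \<le> 2 powr (real (card X) / 3)"
    using m by simp
  also have "\<dots> = (2 ^ card X) powr (1 / 3)"
    by (simp add: powr_powr flip: powr_realpow)
  also have "\<dots> \<le> (real r ^ 3) powr (1 / 3)"
  proof (rule powr_mono2)
    show "2 ^ card X \<le> real r ^ 3"
      using le by (metis of_nat_le_iff of_nat_numeral of_nat_power)
  qed auto
  also have "real r ^ 3 = real r powr 3"
    using \<open>r > 0\<close> by simp
  also have "(real r powr 3) powr (1 / 3) = real r"
    unfolding powr_powr using \<open>r > 0\<close> by simp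
  finally show ?thesis .
qed

end
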